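(* Let $q$ be a prime power, let $m,n,k$ be integers with $2\le k<n\le m$, and let $\lambda\in\mathbb{F}_{q^m}$ with $\mathbb{F}_q(\lambda)=\mathbb{F}_{q^m}$. Let $S=\{i\in\mathbb{Z}_{\ge 0}: (n-i)/2^{k-i-1}\ge 1\}$ and $z=\min S$. If $z=0$, let $\mathbf n=\Psi(n,k)$; if $z>0$, let $(n_1,\dots,n_{k-z})=\Psi(n-z,k-z)$ and $\mathbf n=(n_1,\dots,n_{k-z},1,\dots,1)$ with $z$ trailing ones. Then the $[n,k]_{q^m/q}$ code $\mathcal C_{\lambda,\mathbf n}$ satisfies $$\mathrm{WS}(\mathcal C_{\lambda,\mathbf n})=\{s,s+1,\dots,n\},\qquad s=\max\left\{\left\lfloor \frac{n}{2^{k-1}}\right\rfloor,1\right\},$$ so it has exactly $n-s+1$ distinct nonzero weights.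
   Context: $\mathbb{F}_{q^m}$ is the degree-$m$ extension of $\mathbb{F}_q$. Rank weight of $\mathbf v=(v_1,\dots,v_n)\in\mathbb{F}_{q^m}^n$: $\mathrm{w}(\mathbf v)=\dim_{\mathbb{F}_q}\langle v_1,\dots,v_n\rangle_{\mathbb{F}_q}$. An $[n,k]_{q^m/q}$ code is a $k$-dimensional $\mathbb{F}_{q^m}$-subspace of $\mathbb{F}_{q^m}^n$; its weight spectrum is $\mathrm{WS}(\mathcal C)=\{\mathrm{w}(\mathbf c):\mathbf c\in\mathcal C\setminus\{\mathbf 0\}\}$. For integers $u\ge v\ge 2$, $\Psi(u,v):=(u_1,\dots,u_v)$ with $u_1=\lceil u/2\rceil$, $u_i=\lceil\lfloor u/2^{i-1}\rfloor/2\rceil$ for $2\le i\le v-1$, $u_v=\lfloor u/2^{v-1}\rfloor$. For $\ell\le m$, $\mathbf u_{\lambda,\ell}=(1,\lambda,\dots,\lambda^{\ell-1})\in\mathbb{F}_{q^m}^\ell$. For a tuple $\mathbf n=(n_1,\dots,n_k)$ of integers with $m\ge n_1\ge\dots\ge n_k\ge1$, $\mathcal C_{\lambda,\mathbf n}$ is the code in $\mathbb{F}_{q^m}^{n_1+\dots+n_k}$ with block-diagonal generator matrix whose $i$-th row equals $\mathbf u_{\lambda,n_i}$ on the $i$-th block of $n_i$ coordinates (blocks of consecutive coordinates of lengths $n_1,\dots,n_k$) and $0$ elsewhere. *)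

theory Defs
  imports
    "Jordan_Normal_Form.VS_Connect"
    "HOL-Library.Cardinality"
    "HOL-Algebra.Generated_Fields"
    "HOL-Number_Theory.Prime_Powers"
begin

text \<open>
  A field extension \<open>E / F\<close> is given by two field types and a field homomorphism
  \<open>\<iota> :: 'f \<Rightarrow> 'e\<close>; the field \<open>E\<close> is an \<open>F\<close>-vector space via \<open>a \<cdot> x = \<iota> a * x\<close>.
\<close>

definition ext_scale :: "('f::field \<Rightarrow> 'e::field) \<Rightarrow> 'f \<Rightarrow> 'e \<Rightarrow> 'e" where
  "ext_scale \<iota> a x = \<iota> a * x"

definition ext_degree :: "('f::field \<Rightarrow> 'e::field) \<Rightarrow> nat" where
  "ext_degree \<iota> = vector_space.dim (ext_scale \<iota>) (UNIV :: 'e set)"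

definition adjoin :: "('f::field \<Rightarrow> 'e::field) \<Rightarrow> 'e \<Rightarrow> 'e set" where
  "adjoin \<iota> x = generate_field class_ring (insert x (range \<iota>))"

definition rank_weight :: "('f::field \<Rightarrow> 'e::field) \<Rightarrow> 'e vec \<Rightarrow> nat" where
  "rank_weight \<iota> v =
     vector_space.dim (ext_scale \<iota>) (Modules.module.span (ext_scale \<iota>) (set\<^sub>v v))"

definition is_code :: "nat \<Rightarrow> nat \<Rightarrow> 'e::field vec set \<Rightarrow> bool" where
  "is_code n k C \<longleftrightarrow>
     VectorSpace.subspace class_ring C (module_vec TYPE('e) n) \<and>
     vectorspace.dim class_ring ((module_vec TYPE('e) n)\<lparr>carrier := C\<rparr>) = k"

definition weight_spectrum ::
  "('f::field \<Rightarrow> 'e::field) \<Rightarrow> nat \<Rightarrow> 'e vec set \<Rightarrow> nat set" where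
  "weight_spectrum \<iota> n C = rank_weight \<iota> ` (C - {0\<^sub>v n})"

text \<open>Only meaningful for \<open>u \<ge> v \<ge> 2\<close>; the list entry at position \<open>i - 1\<close> is \<open>u\<^sub>i\<close>.\<close>

definition Psi :: "nat \<Rightarrow> nat \<Rightarrow> nat list" where
  "Psi u v = map (\<lambda>i.
       if i = 1 then nat \<lceil>real u / 2\<rceil>
       else if i < v then nat \<lceil>real_of_int \<lfloor>real u / 2 ^ (i - 1)\<rfloor> / 2\<rceil>
       else nat \<lfloor>real u / 2 ^ (v - 1)\<rfloor>) [1..<Suc v]"

definition power_vec :: "'e::field \<Rightarrow> nat \<Rightarrow> 'e vec" where
  "power_vec x l = vec l (\<lambda>j. x ^ j)"

definition block_gen_mat :: "'e::field \<Rightarrow> nat list \<Rightarrow> 'e mat" where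
  "block_gen_mat x ns = diag_block_mat (map (\<lambda>l. mat_of_row (power_vec x l)) ns)"

definition block_code :: "'e::field \<Rightarrow> nat list \<Rightarrow> 'e vec set" where
  "block_code x ns = vec_space.row_space (sum_list ns) (block_gen_mat x ns)"

end

theory Submission
  imports Defs
begin

text \<open>
  A codeword is \<open>(a\<^sub>1 u\<^sub>1, \<dots>, a\<^sub>k u\<^sub>k)\<close>, and its weight is the dimension of the span of all
  \<open>a\<^sub>i \<lambda>\<^sup>j\<close> with \<open>j < n\<^sub>i\<close>. Since \<open>1, \<lambda>, \<dots>, \<lambda>\<^sup>m\<^sup>-\<^sup>1\<close> are independent over the small field, one nonzero
  \<open>a\<^sub>i\<close> already forces weight at least \<open>n\<^sub>i\<close>, hence at least the last block length \<open>s\<close>. Conversely,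
  if every \<open>a\<^sub>i\<close> is \<open>0\<close> or a power of \<open>\<lambda>\<close>, the \<open>i\<close>-th block contributes either nothing or the powers
  of \<open>\<lambda>\<close> with exponents in an interval of length \<open>n\<^sub>i\<close> placed at will. As halving makes each
  block exceed the sum of the later ones by at most one, such intervals can be arranged to
  cover exactly \<open>{0, \<dots>, w - 1}\<close> for every \<open>w\<close> between \<open>s\<close> and \<open>n\<close>.
\<close>

section \<open>Linear algebra over the small field and the powers of a generator\<close>

lemma (in field_hom) vector_space_ext_scale: "vector_space (ext_scale hom)"
  by unfold_locales (simp_all add: ext_scale_def algebra_simps hom_distribs)

locale finite_ext = field_hom hom
  for hom :: "'f::field \<Rightarrow> 'e::{field,finite}"
begin

sublocale ext: vector_space "ext_scale hom"
  by (rule vector_space_ext_scale)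

lemma dim_le_card: "ext.dim A \<le> card A"
  by (intro ext.dim_le_card ext.span_superset) simp

text \<open>The exchange bound compares a basis of \<open>A\<close> with a basis of
  \<open>B\<close>; it applies because the big field is finite.\<close>

lemma dim_mono:
  assumes "A \<subseteq> ext.span B"
  shows "ext.dim A \<le> ext.dim B"
proof -
  obtain C where C: "C \<subseteq> A" "ext.independent C" "A \<subseteq> ext.span C" "card C = ext.dim A"
    using ext.basis_exists by blast
  obtain D where D: "D \<subseteq> B" "ext.independent D" "B \<subseteq> ext.span D" "card D = ext.dim B"
    using ext.basis_exists by blast
  have "ext.span B \<subseteq> ext.span D"
    using D(3) by (intro ext.span_minimal) auto
  then have "C \<subseteq> ext.span D"
    using C(1) assms by blast
  then show ?thesis
    using ext.independent_span_bound[of D C] C D by auto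
qed

lemma
  shows span_mult: "ext.span ((*) a ` A) = (*) a ` ext.span A"
    and independent_mult: "a \<noteq> 0 \<Longrightarrow> ext.independent A \<Longrightarrow> ext.independent ((*) a ` A)"
proof -
  interpret h: module_hom "ext_scale hom" "ext_scale hom" "(*) a"
    by unfold_locales (simp_all add: ext_scale_def algebra_simps)
  show "ext.span ((*) a ` A) = (*) a ` ext.span A" by (rule h.span_image)
  show "ext.independent ((*) a ` A)" if "a \<noteq> 0" "ext.independent A"
    using that by (intro h.independent_injective_image) (auto simp: inj_on_def)
qed

text \<open>Multiplication by \<open>x\<close> maps the span into itself: only the top generator
  leaves the generating set, and the assumption puts its image \<open>x ^ d\<close> back into the
  span. Induction on \<open>i\<close> follows.\<close>

lemma power_in_span_lower_powers:
  assumes "x ^ d \<in> ext.span ((^) x ` {..<d})"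
  shows "x ^ i \<in> ext.span ((^) x ` {..<d})"
proof (induction i)
  case 0
  show ?case
  proof (cases "d = 0")
    case False
    then have "x ^ 0 \<in> (^) x ` {..<d}" by blast
    then show ?thesis by (rule ext.span_base)
  qed (use assms in simp)
next
  case (Suc i)
  have "(*) x ` (^) x ` {..<d} \<subseteq> ext.span ((^) x ` {..<d})"
  proof (unfold image_image, rule image_subsetI)
    fix j assume "j \<in> {..<d}"
    then have "j < d" by simp
    then show "x * x ^ j \<in> ext.span ((^) x ` {..<d})"
    proof (cases "d = Suc j")
      case False
      then have "x ^ Suc j \<in> (^) x ` {..<d}" using \<open>j < d\<close> by (intro imageI) simp
      then have "x ^ Suc j \<in> ext.span ((^) x ` {..<d})" by (rule ext.span_base)
      then show ?thesis by simp
    qed (use assms in simp)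
  qed
  then have "(*) x ` ext.span ((^) x ` {..<d}) \<subseteq> ext.span ((^) x ` {..<d})"
    unfolding span_mult[symmetric] by (rule ext.span_minimal[OF _ ext.subspace_span])
  then have "x * x ^ i \<in> ext.span ((^) x ` {..<d})"
    using Suc.IH by blast
  then show ?case by simp
qed

text \<open>The span is closed under multiplication, and a finite integral domain is a field.\<close>
lemma adjoin_subset_span_powers:
  assumes "x ^ d \<in> ext.span ((^) x ` {..<d})"
  shows "adjoin hom x \<subseteq> ext.span ((^) x ` {..<d})"
proof -
  let ?W = "ext.span ((^) x ` {..<d})"
  have one: "1 \<in> ?W"
    using power_in_span_lower_powers[OF assms, of 0] by simp
  have power_mult: "x ^ i * w \<in> ?W" if "w \<in> ?W" for i w
  proof -
    have "(*) (x ^ i) ` ?W \<subseteq> ?W"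
      unfolding span_mult[symmetric]
      using power_in_span_lower_powers[OF assms]
      by (intro ext.span_minimal) (auto simp flip: power_add)
    then show ?thesis using that by auto
  qed
  have mult: "v * w \<in> ?W" if "v \<in> ?W" "w \<in> ?W" for v w
  proof -
    have "(*) w ` ?W \<subseteq> ?W"
      unfolding span_mult[symmetric]
      using power_mult[OF that(2)]
      by (intro ext.span_minimal) (auto simp: mult.commute)
    then show ?thesis using that(1) by (auto simp: mult.commute)
  qed
  have inv: "inverse v \<in> ?W" if "v \<in> ?W" "v \<noteq> 0" for v
  proof -
    have "(*) v ` ?W = ?W"
      using that mult by (intro endo_inj_surj) (auto simp: inj_on_def)
    then obtain w where "w \<in> ?W" "v * w = 1"
      using one by (metis imageE)
    then show ?thesis by (metis inverse_unique)
  qed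
  have "w \<in> ?W" if "w \<in> generate_field class_ring (insert x (range hom))" for w
    using that
  proof induction
    case one
    then show ?case using \<open>1 \<in> ?W\<close> by simp
  next
    case (incl h)
    moreover have "hom a \<in> ?W" for a
      using ext.span_scale[OF one, of a] by (simp add: ext_scale_def)
    ultimately show ?case
      using power_in_span_lower_powers[OF assms, of 1] by auto
  next
    case (m_inv h)
    then show ?case using inv by (simp add: class_ring_simps)
  qed (auto simp: class_ring_simps intro: ext.span_neg ext.span_add mult)
  then show ?thesis unfolding adjoin_def by auto
qed

text \<open>If \<open>x ^ l\<close> depended on the lower powers, these at most \<open>l\<close>
  elements would span the whole field, against \<open>l < ext_degree hom\<close>. The cardinality is
  carried along because independence of a set says nothing about coinciding powers.\<close>

lemma independent_powers_of_generator:
  assumes "adjoin hom x = UNIV" "l \<le> ext_degree hom"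
  shows "ext.independent ((^) x ` {..<l}) \<and> card ((^) x ` {..<l}) = l"
  using assms(2)
proof (induction l)
  case (Suc l)
  have "x ^ l \<notin> ext.span ((^) x ` {..<l})"
  proof
    assume "x ^ l \<in> ext.span ((^) x ` {..<l})"
    then have "UNIV \<subseteq> ext.span ((^) x ` {..<l})"
      using adjoin_subset_span_powers assms(1) by blast
    then have "ext_degree hom \<le> card ((^) x ` {..<l})"
      unfolding ext_degree_def by (intro ext.dim_le_card) auto
    also have "\<dots> \<le> l"
      using card_image_le[of "{..<l}"] by simp
    finally show False using Suc.prems by simp
  qed
  moreover from this have "x ^ l \<notin> (^) x ` {..<l}"
    using ext.span_base[of "x ^ l" "(^) x ` {..<l}"] by satx
  ultimately show ?case
    using Suc ext.independent_insertI[of "x ^ l" "(^) x ` {..<l}"] by (simp add: lessThan_Suc)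
qed (simp add: ext.independent_empty)

lemma dim_powers_of_generator:
  assumes "adjoin hom x = UNIV" "l \<le> ext_degree hom"
  shows "ext.dim ((^) x ` {..<l}) = l"
  using independent_powers_of_generator[OF assms] ext.dim_eq_card_independent by metis

lemma dim_mult_powers_of_generator:
  assumes "adjoin hom x = UNIV" "l \<le> ext_degree hom" "a \<noteq> 0"
  shows "ext.dim ((\<lambda>j. a * x ^ j) ` {..<l}) = l"
proof -
  have "card ((*) a ` (^) x ` {..<l}) = l"
    using independent_powers_of_generator[OF assms(1,2)] assms(3)
    by (subst card_image) (auto simp: inj_on_def)
  moreover have "ext.independent ((*) a ` (^) x ` {..<l})"
    using assms by (simp add: independent_mult independent_powers_of_generator)
  ultimately have "ext.dim ((*) a ` (^) x ` {..<l}) = l"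
    using ext.dim_eq_card_independent by metis
  then show ?thesis by (simp add: image_image)
qed

end

section \<open>Codewords of the block code and its dimension\<close>

text \<open>The product of the message \<open>as\<close> with the generator matrix, in a recursive
  form suited to list induction. It is used only for lists of equal length.\<close>

fun block_codeword :: "'e::field \<Rightarrow> 'e list \<Rightarrow> nat list \<Rightarrow> 'e vec" where
  "block_codeword x (a # as) (l # ls) = (a \<cdot>\<^sub>v power_vec x l) @\<^sub>v block_codeword x as ls"
| "block_codeword x _ _ = 0\<^sub>v 0"

lemma block_gen_mat_carrier: "block_gen_mat x ls \<in> carrier_mat (length ls) (sum_list ls)"
  unfolding block_gen_mat_def
  by (rule carrier_matI) (simp_all add: dim_diag_block_mat comp_def power_vec_def sum_list_triv)

lemma block_codeword_carrier:
  "length as = length ls \<Longrightarrow> block_codeword x as ls \<in> carrier_vec (sum_list ls)"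
  by (induction as ls rule: list_induct2) (simp_all add: power_vec_def)

lemma transpose_block_gen_mat_mult_vec:
  assumes "length as = length ls"
  shows "(block_gen_mat x ls)\<^sup>T *\<^sub>v vec_of_list as = block_codeword x as ls"
  using assms
proof (induction as ls rule: list_induct2)
  case Nil
  then show ?case by (auto simp: block_gen_mat_def)
next
  case (Cons a as l ls)
  let ?U = "mat_of_row (power_vec x l)" and ?B = "block_gen_mat x ls"
  let ?n = "sum_list ls" and ?k = "length ls"
  have U: "?U \<in> carrier_mat 1 l" by (intro mat_of_row_carrier) (simp add: power_vec_def)
  have B: "?B \<in> carrier_mat ?k ?n" by (rule block_gen_mat_carrier)
  have a: "vec_of_list [a] \<in> carrier_vec 1" by (rule carrier_vecI) simp
  have as: "vec_of_list as \<in> carrier_vec ?k" using Cons.hyps by (intro carrier_vecI) simp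
  have T: "(block_gen_mat x (l # ls))\<^sup>T = four_block_mat ?U\<^sup>T (0\<^sub>m l ?k) (0\<^sub>m ?n 1) ?B\<^sup>T"
    using transpose_four_block_mat[of ?U 1 l "0\<^sub>m 1 ?n" ?n "0\<^sub>m ?k l" ?k ?B] U B
      carrier_matD[OF B]
    by (simp add: block_gen_mat_def Let_def power_vec_def)
  have "vec_of_list (a # as) = vec_of_list [a] @\<^sub>v vec_of_list as"
    by simp
  moreover have "?U\<^sup>T *\<^sub>v vec_of_list [a] = a \<cdot>\<^sub>v power_vec x l"
    by (intro eq_vecI) (auto simp: scalar_prod_def power_vec_def mat_of_row_def)
  moreover have "a \<cdot>\<^sub>v power_vec x l + 0\<^sub>m l ?k *\<^sub>v vec_of_list as = a \<cdot>\<^sub>v power_vec x l"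
    using as by (intro eq_vecI) (auto simp: power_vec_def)
  moreover have "0\<^sub>m ?n 1 *\<^sub>v vec_of_list [a] + ?B\<^sup>T *\<^sub>v vec_of_list as = ?B\<^sup>T *\<^sub>v vec_of_list as"
    using a as B by (intro eq_vecI) auto
  ultimately show ?case
    using four_block_mat_mult_vec[of "?U\<^sup>T" l 1 "0\<^sub>m l ?k" ?k "0\<^sub>m ?n 1" ?n "?B\<^sup>T" "vec_of_list [a]" "vec_of_list as"]
      U B a as Cons.IH
    by (simp add: T)
qed

lemma block_code_eq_codewords:
  "block_code x ls = (\<lambda>as. block_codeword x as ls) ` {as. length as = length ls}"
proof -
  interpret vec_space "TYPE('a)" "sum_list ls" .
  have carrier: "carrier_vec (length ls) = vec_of_list ` {as :: 'a list. length as = length ls}"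
  proof (intro equalityI subsetI)
    fix y :: "'a vec" assume "y \<in> carrier_vec (length ls)"
    then show "y \<in> vec_of_list ` {as. length as = length ls}"
      by (intro image_eqI[of _ _ "list_of_vec y"]) (simp_all add: vec_list)
  qed (auto intro: carrier_vecI)
  have "block_code x ls
      = {w \<in> carrier_vec (sum_list ls). \<exists>y\<in>carrier_vec (length ls). (block_gen_mat x ls)\<^sup>T *\<^sub>v y = w}"
    using row_space_eq[OF block_gen_mat_carrier[of x ls]] carrier_matD[OF block_gen_mat_carrier[of x ls]]
    by (simp add: block_code_def)
  also have "\<dots> = (\<lambda>as. block_codeword x as ls) ` {as. length as = length ls}"
    unfolding carrier using transpose_block_gen_mat_mult_vec[of _ ls x] block_codeword_carrier[of _ ls x]
    by auto
  finally show ?thesis .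
qed

lemma set_append_vec: "set\<^sub>v (v @\<^sub>v w) = set\<^sub>v v \<union> set\<^sub>v w"
  by (simp flip: set_list_of_vec)

text \<open>The rank weight sees only the set of entries, so this union can stand for the codeword
  in every weight argument.\<close>

lemma set_block_codeword:
  "set\<^sub>v (block_codeword x as ls) = (\<Union>(a, l)\<in>set (zip as ls). (\<lambda>j. a * x ^ j) ` {..<l})"
proof (induction x as ls rule: block_codeword.induct)
  case (1 x a as l ls)
  have "set\<^sub>v (a \<cdot>\<^sub>v power_vec x l) = (\<lambda>j. a * x ^ j) ` {..<l}"
    by (force simp: vec_set_def power_vec_def)
  then show ?case using 1 by (simp add: set_append_vec)
qed (simp_all add: vec_set_def)

lemma eq_zero_vec_iff_set: "v \<in> carrier_vec n \<Longrightarrow> v = 0\<^sub>v n \<longleftrightarrow> set\<^sub>v v \<subseteq> {0}"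
  unfolding vec_set_def image_subset_iff vec_eq_iff by fastforce

lemma block_codeword_eq_zero:
  assumes "length as = length ls" "0 \<notin> set ls" "block_codeword x as ls = 0\<^sub>v (sum_list ls)"
  shows "as = replicate (length ls) 0"
proof (rule replicate_eqI)
  fix a assume "a \<in> set as"
  then obtain l where al: "(a, l) \<in> set (zip as ls)"
    using assms(1) by (metis in_set_impl_in_set_zip1)
  then have "l > 0" using assms(2) by (metis gr0I set_zip_rightD)
  have "set\<^sub>v (block_codeword x as ls) \<subseteq> {0}"
    using assms(3) eq_zero_vec_iff_set[OF block_codeword_carrier[OF assms(1)]] by blast
  \<comment> \<open>A block of positive length has its coefficient itself as first entry.\<close>
  then have "a * x ^ 0 \<in> {0}"
    using al \<open>l > 0\<close> unfolding set_block_codeword by blast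
  then show "a = 0" by simp
qed (rule assms(1))

text \<open>The row space is the image of the transpose acting on column vectors. A trivial kernel
  and rank-nullity then give dimension \<open>k\<close>.\<close>

lemma is_code_row_space:
  fixes A :: "'e::field mat"
  assumes A: "A \<in> carrier_mat k n"
    and inj: "\<And>y. y \<in> carrier_vec k \<Longrightarrow> A\<^sup>T *\<^sub>v y = 0\<^sub>v n \<Longrightarrow> y = 0\<^sub>v k"
  shows "is_code n k (vec_space.row_space n A)"
proof -
  interpret K: vec_space "TYPE('e)" k .
  interpret N: vec_space "TYPE('e)" n .
  interpret T: linear_map "class_ring :: 'e ring" "module_vec TYPE('e) k" "module_vec TYPE('e) n"
    "\<lambda>y. A\<^sup>T *\<^sub>v y"
  proof (intro linear_map.intro mod_hom.intro mod_hom_axioms.intro)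
    show "vectorspace class_ring (module_vec TYPE('e) k)" "vectorspace class_ring (module_vec TYPE('e) n)"
      by (rule vec_vs)+
    then show "Module.module class_ring (module_vec TYPE('e) k)" "Module.module class_ring (module_vec TYPE('e) n)"
      by (simp_all add: vectorspace_def)
    show "(*\<^sub>v) A\<^sup>T \<in> LinearCombinations.module_hom class_ring (module_vec TYPE('e) k) (module_vec TYPE('e) n)"
      using A mult_add_distrib_mat_vec[of "A\<^sup>T" n k] mult_mat_vec[of "A\<^sup>T" n k]
      by (auto simp: LinearCombinations.module_hom_def module_vec_simps)
  qed
  have im: "T.im = N.row_space A"
    using A unfolding T.im_def N.row_space_eq[OF A] by (auto simp: module_vec_simps)
  have "inj_on (\<lambda>y. A\<^sup>T *\<^sub>v y) (carrier_vec k)"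
  proof (rule inj_onI)
    fix y y' assume y: "y \<in> carrier_vec k" "y' \<in> carrier_vec k" and eq: "A\<^sup>T *\<^sub>v y = A\<^sup>T *\<^sub>v y'"
    then have "A\<^sup>T *\<^sub>v (y - y') = 0\<^sub>v n"
      using A by (simp add: mult_minus_distrib_mat_vec[of _ n k])
    then have "y - y' = 0\<^sub>v k" using inj y by simp
    then have "y - y' + y' = y'" using y by simp
    moreover have "y - y' + y' = y" using y by auto
    ultimately show "y = y'" by simp
  qed
  then have "vectorspace.dim class_ring (N.vs T.im) = k"
    using T.rank_nullity T.inj_imp_dim_ker0 K.fin_dim K.dim_is_n
    by (simp add: module_vec_simps)
  then show ?thesis
    using T.imT_is_subspace unfolding is_code_def im by simp
qed

lemma is_code_block_code:
  assumes "0 \<notin> set ls"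
  shows "is_code (sum_list ls) (length ls) (block_code x ls)"
  unfolding block_code_def
proof (rule is_code_row_space[OF block_gen_mat_carrier])
  fix y :: "'a vec"
  assume y: "y \<in> carrier_vec (length ls)" and eq: "(block_gen_mat x ls)\<^sup>T *\<^sub>v y = 0\<^sub>v (sum_list ls)"
  have len: "length (list_of_vec y) = length ls" using y by simp
  have "block_codeword x (list_of_vec y) ls = 0\<^sub>v (sum_list ls)"
    using eq transpose_block_gen_mat_mult_vec[OF len, of x] by (simp add: vec_list)
  then have "list_of_vec y = replicate (length ls) 0"
    using block_codeword_eq_zero[OF len assms] by blast
  also have "\<dots> = list_of_vec (0\<^sub>v (length ls))"
    by (rule nth_equalityI) (simp_all add: list_of_vec_index)
  finally show "y = 0\<^sub>v (length ls)"
    by (metis vec_list)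
qed

section \<open>Covering an initial interval of exponents by blocks\<close>

text \<open>The pattern with two leading entries exempts the last entry, which would otherwise be
  forced to be at most 1.\<close>

fun gapless :: "nat list \<Rightarrow> bool" where
  "gapless (x # y # ys) \<longleftrightarrow> x \<le> Suc (sum_list (y # ys)) \<and> gapless (y # ys)"
| "gapless _ \<longleftrightarrow> True"

lemma gapless_Cons: "xs \<noteq> [] \<Longrightarrow> gapless (x # xs) \<longleftrightarrow> x \<le> Suc (sum_list xs) \<and> gapless xs"
  by (cases xs) simp_all

lemma shifted_powers: "(\<lambda>j. x ^ e * x ^ j) ` {..<l} = (^) x ` {e..<e + l}" for x :: "'e::field"
proof -
  have "(\<lambda>j. x ^ e * x ^ j) ` {..<l} = (^) x ` (+) e ` {..<l}"
    by (simp add: image_image power_add)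
  also have "(+) e ` {..<l} = {e..<e + l}"
    by (simp add: lessThan_atLeast0 add.commute)
  finally show ?thesis .
qed

text \<open>The inserted 0 absorbs the entries of blocks with coefficient 0. When the first block is
  used, \<open>w > sum_list ls\<close> and gaplessness give \<open>l \<le> w\<close>, so
  \<open>w - l\<close> is a true difference, while \<open>w \<le> l + sum_list ls\<close> makes the
  block meet the part already covered.\<close>

lemma gapless_cover:
  fixes x :: "'e::field"
  assumes "gapless ls" "ls \<noteq> []" "last ls \<le> w" "w \<le> sum_list ls"
  shows "\<exists>as. length as = length ls \<and>
    insert 0 (\<Union>(a, l)\<in>set (zip as ls). (\<lambda>j. a * x ^ j) ` {..<l}) = insert 0 ((^) x ` {..<w})"
  using assms
proof (induction ls arbitrary: w)
  case (Cons l ls)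
  let ?U = "\<lambda>as ls. \<Union>(a, l)\<in>set (zip as ls). (\<lambda>j. a * x ^ j) ` {..<l}"
  show ?case
  proof (cases "ls = []")
    case True
    then have "w = l" using Cons.prems by simp
    then show ?thesis using True by (intro exI[of _ "[1]"]) simp
  next
    case False
    then have ls: "l \<le> Suc (sum_list ls)" "gapless ls"
      using Cons.prems(1) by (simp_all add: gapless_Cons)
    have last: "last ls \<le> w" using Cons.prems(3) False by simp
    show ?thesis
    proof (cases "w \<le> sum_list ls")
      case True
      then obtain as where as: "length as = length ls"
          "insert 0 (?U as ls) = insert 0 ((^) x ` {..<w})"
        using Cons.IH[OF ls(2) False last] by blast
      have "insert 0 (?U (0 # as) (l # ls)) = insert 0 (?U as ls)"
        by auto
      then show ?thesis using as by (intro exI[of _ "0 # as"]) simp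
    next
      case greater: False
      have "last ls \<le> sum_list ls"
        using False by (simp add: member_le_sum_list)
      then obtain as where as: "length as = length ls"
          "insert 0 (?U as ls) = insert 0 ((^) x ` {..<sum_list ls})"
        using Cons.IH[OF ls(2) False] by blast
      \<comment> \<open>The first block is placed so as to end at \<open>w\<close>; it reaches back to the part covered by the rest.\<close>
      have "{w - l..<w - l + l} \<union> {..<sum_list ls} = {..<w}"
        using greater ls(1) Cons.prems(4) by auto
      then have "(^) x ` {w - l..<w - l + l} \<union> (^) x ` {..<sum_list ls} = (^) x ` {..<w}"
        by (metis image_Un)
      moreover have "insert 0 (?U (x ^ (w - l) # as) (l # ls))
          = (^) x ` {w - l..<w - l + l} \<union> insert 0 (?U as ls)"
        by (simp add: shifted_powers)
      ultimately show ?thesis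
        using as by (intro exI[of _ "x ^ (w - l) # as"]) simp
    qed
  qed
qed simp

section \<open>The tuple \<open>Psi\<close> as iterated halving\<close>

text \<open>Splits off the upper half of \<open>u\<close> and continues with the lower half;
  \<open>v\<close> counts the splittings, one fewer than the entries.\<close>

fun halving :: "nat \<Rightarrow> nat \<Rightarrow> nat list" where
  "halving u 0 = [u]"
| "halving u (Suc v) = Suc u div 2 # halving (u div 2) v"

lemma length_halving [simp]: "length (halving u v) = Suc v"
  by (induction v arbitrary: u) simp_all

lemma halving_not_Nil [simp]: "halving u v \<noteq> []"
  by (cases v) simp_all

lemma nth_halving:
  "i \<le> v \<Longrightarrow> halving u v ! i = (if i < v then Suc (u div 2 ^ i) div 2 else u div 2 ^ v)"
proof (induction v arbitrary: u i)
  case (Suc v)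
  then show ?case by (cases i) (auto simp: div_mult2_eq)
qed simp

lemma floor_divide_power2: "\<lfloor>real u / 2 ^ j\<rfloor> = int (u div 2 ^ j)"
  using floor_divide_of_nat_eq[of u "2 ^ j", where 'a = real] by simp

text \<open>At least one splitting is required: a tuple of length 1 would fall under the first case
  of \<open>Psi\<close> and get half of \<open>u\<close> instead of \<open>u\<close>.\<close>

lemma Psi_eq_halving:
  assumes "v \<ge> 1"
  shows "Psi u (Suc v) = halving u v"
proof (rule nth_equalityI)
  have ceiling: "nat \<lceil>real a / 2\<rceil> = Suc a div 2" for a
    by linarith
  fix i assume "i < length (Psi u (Suc v))"
  then have "i \<le> v" by (simp add: Psi_def del: upt_Suc)
  then show "Psi u (Suc v) ! i = halving u v ! i"
    using assms by (auto simp: Psi_def nth_halving floor_divide_power2 ceiling nth_append simp del: upt_Suc)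
qed (simp add: Psi_def)

lemma sum_list_halving [simp]: "sum_list (halving u v) = u"
proof (induction v arbitrary: u)
  case (Suc v)
  then show ?case by simp
qed simp

lemma last_halving [simp]: "last (halving u v) = u div 2 ^ v"
  by (induction v arbitrary: u) (simp_all add: div_mult2_eq)

lemma last_le_halving: "l \<in> set (halving u v) \<Longrightarrow> u div 2 ^ v \<le> l"
proof (induction v arbitrary: u)
  case (Suc v)
  have "u div 2 div 2 ^ v \<le> Suc u div 2"
    by (meson div_le_dividend div_le_mono le_SucI le_trans order_refl)
  then show ?case using Suc by (auto simp: div_mult2_eq)
qed simp

text \<open>The upper half of \<open>u\<close> exceeds the lower half by at most one. The last
  halving entry is unconstrained if nothing follows; if ones follow, the bound by 1 keeps it
  admissible.\<close>

lemma gapless_halving_append: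
  assumes "z = 0 \<or> u div 2 ^ v \<le> 1"
  shows "gapless (halving u v @ replicate z 1)"
  using assms
proof (induction v arbitrary: u)
  case 0
  have ones: "gapless (replicate z 1)" for z
  proof (induction z)
    case (Suc z)
    then show ?case by (cases z) auto
  qed simp
  show ?case
    using 0 ones by (cases "z = 0") (auto simp: gapless_Cons sum_list_replicate)
next
  case (Suc v)
  then show ?case
    by (simp add: gapless_Cons div_mult2_eq sum_list_replicate)
qed

section \<open>The weight spectrum\<close>

lemma (in finite_ext) rank_weight_eq_dim: "rank_weight hom v = ext.dim (set\<^sub>v v)"
  by (simp add: rank_weight_def)

lemma (in finite_ext) weight_spectrum_block_code:
  assumes x: "adjoin hom x = UNIV" and deg: "sum_list ls \<le> ext_degree hom"
    and ls: "gapless ls" "ls \<noteq> []" "0 < last ls" "\<And>l. l \<in> set ls \<Longrightarrow> last ls \<le> l"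
  shows "weight_spectrum hom (sum_list ls) (block_code x ls) = {last ls..sum_list ls}"
proof (intro equalityI subsetI)
  fix w assume "w \<in> weight_spectrum hom (sum_list ls) (block_code x ls)"
  then obtain as where len: "length as = length ls"
      and nz: "block_codeword x as ls \<noteq> 0\<^sub>v (sum_list ls)"
      and w: "w = ext.dim (set\<^sub>v (block_codeword x as ls))"
    unfolding weight_spectrum_def block_code_eq_codewords rank_weight_eq_dim by blast
  have "\<not> set\<^sub>v (block_codeword x as ls) \<subseteq> {0}"
    using nz eq_zero_vec_iff_set[OF block_codeword_carrier[OF len]] by blast
  then obtain a l where al: "(a, l) \<in> set (zip as ls)" "a \<noteq> 0"
    unfolding set_block_codeword by fastforce
  have l: "l \<in> set ls" using al(1) by (rule set_zip_rightD)
  have "l \<le> ext_degree hom"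
    using member_le_sum_list[OF l] deg by simp
  then have "l = ext.dim ((\<lambda>j. a * x ^ j) ` {..<l})"
    using dim_mult_powers_of_generator[OF x _ al(2)] by simp
  also have "\<dots> \<le> w"
  proof -
    have "(\<lambda>j. a * x ^ j) ` {..<l} \<subseteq> set\<^sub>v (block_codeword x as ls)"
      unfolding set_block_codeword using al(1) by blast
    then show ?thesis
      unfolding w by (intro dim_mono order_trans[OF _ ext.span_superset])
  qed
  finally have "last ls \<le> w" using ls(4)[OF l] by simp
  moreover have "w \<le> sum_list ls"
  proof -
    have "w \<le> card (set\<^sub>v (block_codeword x as ls))"
      unfolding w by (rule dim_le_card)
    also have "\<dots> \<le> dim_vec (block_codeword x as ls)"
      unfolding vec_set_def using card_image_le[of "{..<dim_vec _}"] by simp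
    finally show ?thesis
      using carrier_vecD[OF block_codeword_carrier[OF len, of x]] by simp
  qed
  ultimately show "w \<in> {last ls..sum_list ls}" by simp
next
  fix w assume w: "w \<in> {last ls..sum_list ls}"
  then obtain as where len: "length as = length ls"
      and cover: "insert 0 (set\<^sub>v (block_codeword x as ls)) = insert 0 ((^) x ` {..<w})"
    using gapless_cover[OF ls(1,2), of w x] unfolding set_block_codeword by auto
  let ?c = "block_codeword x as ls"
  \<comment> \<open>Inserting 0 does not change the span, so the two covered sets have the same
    dimension.\<close>
  have "ext.dim (set\<^sub>v ?c) = ext.dim ((^) x ` {..<w})"
    using cover by (metis ext.span_eq_dim ext.span_insert_0)
  also have "\<dots> = w"
    using w deg by (intro dim_powers_of_generator[OF x]) simp
  finally have rank: "rank_weight hom ?c = w"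
    unfolding rank_weight_eq_dim .
  have "?c \<noteq> 0\<^sub>v (sum_list ls)"
  proof
    assume "?c = 0\<^sub>v (sum_list ls)"
    then have "set\<^sub>v ?c \<subseteq> ext.span {}"
      using eq_zero_vec_iff_set[OF block_codeword_carrier[OF len]] by simp
    then have "ext.dim (set\<^sub>v ?c) \<le> card ({} :: 'e set)"
      by (rule ext.dim_le_card) simp
    then show False
      using rank w ls(3) by (simp add: rank_weight_eq_dim)
  qed
  then show "w \<in> weight_spectrum hom (sum_list ls) (block_code x ls)"
    unfolding weight_spectrum_def block_code_eq_codewords using len rank by blast
qed

theorem theorem3p5:
  fixes \<iota> :: "'f::{field,finite} \<Rightarrow> 'e::{field,finite}"
    and lam :: 'e
    and q m n k z s :: nat
    and S :: "nat set"
    and ns :: "nat list"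
  assumes "primepow q"
    and "CARD('f) = q"
    and "field_hom \<iota>"
    and "ext_degree \<iota> = m"
    and "2 \<le> k" and "k < n" and "n \<le> m"
    and "adjoin \<iota> lam = UNIV"
    and "S = {i. (real n - real i) / 2 powi (int k - int i - 1) \<ge> 1}"
    and "z = (LEAST i. i \<in> S)"
    and "ns = (if z = 0 then Psi n k else Psi (n - z) (k - z) @ replicate z 1)"
    and "s = max (nat \<lfloor>real n / 2 ^ (k - 1)\<rfloor>) 1"
  shows "is_code n k (block_code lam ns)
    \<and> weight_spectrum \<iota> n (block_code lam ns) = {s..n}
    \<and> card (weight_spectrum \<iota> n (block_code lam ns)) = n - s + 1"
proof -
  interpret finite_ext \<iota> using assms(3) by (rule finite_ext.intro)
  \<comment> \<open>For \<open>i < k\<close> the integer exponent is nonnegative, so membership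
    becomes an inequality of natural numbers.\<close>
  have S_iff: "i \<in> S \<longleftrightarrow> 2 ^ (k - i - 1) \<le> n - i" if "i < k" for i
  proof -
    have "int k - int i - 1 = int (k - i - 1)" using that by simp
    then have "2 powi (int k - int i - 1) = real (2 ^ (k - i - 1))"
      by (simp only: power_int_of_nat) simp
    moreover have "real n - real i = real (n - i)"
      using that assms(6) by (simp add: of_nat_diff)
    ultimately have "i \<in> S \<longleftrightarrow> 1 \<le> real (n - i) / real (2 ^ (k - i - 1))"
      unfolding assms(9) by (simp only: mem_Collect_eq)
    also have "\<dots> \<longleftrightarrow> real (2 ^ (k - i - 1)) \<le> real (n - i)"
      by (rule le_divide_eq_1_pos) simp
    finally show ?thesis by (simp only: of_nat_le_iff)
  qed
  \<comment> \<open>Here the condition reads \<open>2 \<le> n - (k - 2)\<close>, which follows from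
    \<open>k < n\<close>. It leaves at least two blocks for \<open>Psi\<close>.\<close>
  have "k - 2 \<in> S"
    using assms(5,6) S_iff[of "k - 2"] by simp
  then have zS: "z \<in> S" and z: "z \<le> k - 2"
    unfolding assms(10) using LeastI[of "\<lambda>i. i \<in> S"] Least_le[of "\<lambda>i. i \<in> S"] by auto
  have z_min: "i \<notin> S" if "i < z" for i
    using that not_less_Least[of i "\<lambda>i. i \<in> S"] unfolding assms(10) by blast
  define v where "v = k - z - 1"
  have v: "v \<ge> 1" "k - z = Suc v" "k = Suc v + z"
    using z assms(5) unfolding v_def by auto
  have ns: "ns = halving (n - z) v @ replicate z 1"
    using assms(11) v Psi_eq_halving[OF v(1), of "n - z"] by (cases "z = 0") simp_all
  \<comment> \<open>Membership of \<open>z\<close> in \<open>S\<close> says exactly that the last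
    entry of \<open>Psi\<close> is positive.\<close>
  have pos: "0 < (n - z) div 2 ^ v"
    using S_iff[of z] zS v by (simp add: div_greater_zero_iff)
  \<comment> \<open>Needed because the last entry of \<open>Psi\<close> is followed by ones.\<close>
  have le1: "(n - z) div 2 ^ v \<le> 1" if "z > 0"
  proof -
    \<comment> \<open>By minimality of \<open>z\<close>, the index \<open>z - 1\<close> fails the
      condition, whose exponent there is one larger.\<close>
    have "n - (z - 1) < 2 ^ (k - (z - 1) - 1)"
      using S_iff[of "z - 1"] z_min[of "z - 1"] that v(3) by simp
    moreover have "k - (z - 1) - 1 = Suc v" using that v(3) by simp
    ultimately have "n - z < 2 * 2 ^ v" using that by simp
    then have "(n - z) div 2 ^ v < 2" by (simp add: less_mult_imp_div_less)
    then show ?thesis by simp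
  qed
  have s: "last ns = s"
  proof -
    have fl: "nat \<lfloor>real n / 2 ^ (k - 1)\<rfloor> = n div 2 ^ (k - 1)"
      by (simp add: floor_divide_power2)
    show ?thesis
    proof (cases "z = 0")
      case True
      then show ?thesis using fl pos v(3) unfolding assms(12) ns by simp
    next
      case False
      \<comment> \<open>Since 0 is not in \<open>S\<close>, the floor in \<open>s\<close> vanishes
        and the maximum is 1, the trailing entry.\<close>
      then have "n < 2 ^ (k - 1)"
        using S_iff[of 0] z_min[of 0] assms(5) by simp
      then show ?thesis using fl False unfolding assms(12) ns by simp
    qed
  qed
  have s_le: "last ns \<le> l" if "l \<in> set ns" for l
  proof (cases "z = 0")
    case True
    then show ?thesis using that last_le_halving[of l n v] unfolding ns by simp
  next
    case False
    then have "last ns = 1" unfolding ns by simp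
    moreover have "1 \<le> l"
      using that pos last_le_halving[of l "n - z" v] unfolding ns by auto
    ultimately show ?thesis by simp
  qed
  have len: "length ns = k" and sum: "sum_list ns = n"
    using v(3) assms(6) unfolding ns by (simp_all add: sum_list_replicate)
  have "s \<ge> 1" unfolding assms(12) by simp
  then have "0 \<notin> set ns" using s s_le by fastforce
  then have code: "is_code n k (block_code lam ns)"
    using is_code_block_code[of ns lam] len sum by simp
  have "gapless ns"
    unfolding ns using le1 by (intro gapless_halving_append) auto
  moreover have "ns \<noteq> []" unfolding ns by simp
  ultimately have WS: "weight_spectrum \<iota> n (block_code lam ns) = {s..n}"
    using weight_spectrum_block_code[OF assms(8), of ns] s s_le \<open>s \<ge> 1\<close> assms(4,7) sum by simp
  \<comment> \<open>The interval must be nonempty for its cardinality to be \<open>n - s + 1\<close>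
    with truncated subtraction.\<close>
  have "s \<le> n"
    using s member_le_sum_list[of "last ns" ns] last_in_set[OF \<open>ns \<noteq> []\<close>] sum by simp
  then show ?thesis using code WS by simp
qed

end
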